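(* Let $\alpha\neq 0$ be a real number, and let $n,i$ be nonnegative integers with $i\le n$. Then $$s(n,i,\alpha)=\sum_{k=0}^{n-i}\binom{n}{k}(-\alpha)_k\,s(n-k,i).$$
   Context: For a real number $x$ and a nonnegative integer $k$, $(x)_k=x(x-1)\cdots(x-k+1)$ is the falling factorial, with $(x)_0=1$; thus $(-\alpha)_k=(-\alpha)(-\alpha-1)\cdots(-\alpha-k+1)$. $s(m,i)$ (two arguments) denotes the signed Stirling numbers of the first kind: $(x)_m=\sum_{i=0}^m s(m,i)x^i$. $s(n,i,\alpha)$ (three arguments) denotes the non-central Stirling numbers of the first kind, for $0\le i\le n$ and $\alpha\in\mathbb R$. They are given by $s(0,0,\alpha)=1$ and, for every integer $n\ge 0$, $$s(n+1,0,\alpha)=(-\alpha-n)\,s(n,0,\alpha),$$ $$s(n+1,i,\alpha)=(-\alpha-n)\,s(n,i,\alpha)+s(n,i-1,\alpha)\quad(i=1,\ldots,n),$$ $$s(n+1,n+1,\alpha)=s(n,n,\alpha).$$ *)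

theory Defs
  imports Complex_Main "HOL-Computational_Algebra.Polynomial" "HOL-Combinatorics.Stirling"
begin

text \<open>The falling factorial is defined over any commutative ring so that it can be used both for
  real numbers and for the polynomial indeterminate.\<close>

definition falling_fact :: "'a::comm_ring_1 \<Rightarrow> nat \<Rightarrow> 'a" where
  "falling_fact x k = (\<Prod>j<k. x - of_nat j)"

text \<open>\<^term>\<open>[:0, 1:]\<close> is the indeterminate, so this is the coefficient of the \<open>i\<close>-th power in
  the expansion of the falling factorial of order \<open>m\<close>. By
  \<open>falling_fact_eq_sum_signed_stirling\<close> and \<open>signed_stirling_unique\<close> these are the only real numbers
  satisfying the defining expansion.\<close>

definition signed_stirling :: "nat \<Rightarrow> nat \<Rightarrow> real" where
  "signed_stirling m i = coeff (falling_fact [:0, 1:] m) i"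

text \<open>Only \<open>i \<le> n\<close> is meaningful; outside this range the value is set to 0.\<close>

fun noncentral_stirling :: "nat \<Rightarrow> nat \<Rightarrow> real \<Rightarrow> real" where
  "noncentral_stirling 0 0 \<alpha> = 1"
| "noncentral_stirling 0 (Suc i) \<alpha> = 0"
| "noncentral_stirling (Suc n) 0 \<alpha> = (- \<alpha> - real n) * noncentral_stirling n 0 \<alpha>"
| "noncentral_stirling (Suc n) (Suc i) \<alpha> =
     (if Suc i \<le> n
      then (- \<alpha> - real n) * noncentral_stirling n (Suc i) \<alpha> + noncentral_stirling n i \<alpha>
      else if i = n then noncentral_stirling n n \<alpha>
      else 0)"

lemma falling_fact_0 [simp]: "falling_fact x 0 = 1"
  by (simp add: falling_fact_def)

lemma falling_fact_Suc: "falling_fact x (Suc k) = falling_fact x k * (x - of_nat k)"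
  by (simp add: falling_fact_def)

lemma poly_falling_fact: "poly (falling_fact p m) x = falling_fact (poly p x) m"
  by (induction m) (simp_all add: falling_fact_Suc)

lemma degree_falling_fact_le: "degree (falling_fact ([:0, 1:] :: real poly) m) \<le> m"
proof (induction m)
  case (Suc m)
  have "degree ([:0, 1:] - of_nat m :: real poly) \<le> 1"
    by (intro degree_diff_le) auto
  with Suc show ?case
    unfolding falling_fact_Suc by (intro order.trans[OF degree_mult_le]) simp
qed simp

lemma falling_fact_eq_sum_signed_stirling:
  "falling_fact x m = (\<Sum>i\<le>m. signed_stirling m i * x ^ i)"
proof -
  have "falling_fact x m = poly (falling_fact [:0, 1:] m) x"
    by (simp add: poly_falling_fact)
  also have "\<dots> = (\<Sum>i\<le>m. signed_stirling m i * x ^ i)"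
    unfolding signed_stirling_def poly_altdef
    using degree_falling_fact_le[of m]
    by (intro sum.mono_neutral_left) (auto simp: coeff_eq_0)
  finally show ?thesis .
qed

lemma signed_stirling_unique:
  assumes "\<And>x::real. falling_fact x m = (\<Sum>i\<le>m. c i * x ^ i)" and "i \<le> m"
  shows "c i = signed_stirling m i"
  using assms polyfun_eq_coeffs[of c m "signed_stirling m"]
  by (simp add: falling_fact_eq_sum_signed_stirling)

lemma signed_stirling_eq_stirling:
  "signed_stirling m i = (- 1) ^ (m + i) * real (stirling m i)"
proof (induction m arbitrary: i)
  case 0
  show ?case by (cases i) (simp_all add: signed_stirling_def)
next
  case (Suc m)
  have "signed_stirling (Suc m) i =
      coeff (pCons 0 (falling_fact [:0, 1:] m) - smult (real m) (falling_fact [:0, 1:] m)) i"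
    by (simp add: signed_stirling_def falling_fact_Suc algebra_simps of_nat_poly)
  then show ?case
    using Suc.IH by (cases i; cases m) (auto simp: signed_stirling_def algebra_simps)
qed

end

theory Submission
  imports Defs
begin

text \<open>The recurrence says that \<open>s(n,i,\<alpha>)\<close> is the coefficient of \<open>x\<^sup>i\<close> in \<open>(x - \<alpha>)\<^sub>n\<close>. The
  Chu--Vandermonde identity expands \<open>(x - \<alpha>)\<^sub>n\<close> as a sum of the terms
  \<open>(n choose k) (-\<alpha>)\<^sub>k (x)\<^bsub>n-k\<^esub>\<close>, and one compares coefficients.\<close>

text \<open>Stated over any commutative ring because it is applied to polynomials. The new factor
  \<open>a + b - n\<close> splits as \<open>(a - k) + (b - (n - k))\<close>; each part lengthens one
  of the two falling factorials.\<close>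

lemma falling_fact_add:
  fixes a b :: "'a::comm_ring_1"
  shows "falling_fact (a + b) n =
    (\<Sum>k\<le>n. of_nat (n choose k) * falling_fact a k * falling_fact b (n - k))"
proof (induction n)
  case 0
  show ?case by simp
next
  case (Suc n)
  let ?f = "\<lambda>k. of_nat (n choose k) * falling_fact a (Suc k) * falling_fact b (n - k)"
  let ?g = "\<lambda>k. of_nat (n choose k) * falling_fact a k * falling_fact b (Suc n - k)"
  have split: "of_nat (n choose k) * falling_fact a k * falling_fact b (n - k) * (a + b - of_nat n)
      = ?f k + ?g k" if "k \<le> n" for k
  proof -
    have "a + b - of_nat n = (a - of_nat k) + (b - of_nat (n - k))"
      using that by (simp add: of_nat_diff)
    then show ?thesis
      using that by (simp add: Suc_diff_le falling_fact_Suc algebra_simps)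
  qed
  have "falling_fact (a + b) (Suc n) = (\<Sum>k\<le>n. ?f k + ?g k)"
    by (simp add: falling_fact_Suc Suc.IH sum_distrib_right split)
  \<comment> \<open>The added term of \<open>?g\<close> vanishes since
    \<open>n choose Suc n = 0\<close>.\<close>
  also have "\<dots> = (\<Sum>k\<le>n. ?f k) + (\<Sum>k\<le>Suc n. ?g k)"
    by (simp add: sum.distrib binomial_eq_0)
  also have "\<dots> = (\<Sum>k\<le>Suc n. of_nat (Suc n choose k) * falling_fact a k * falling_fact b (Suc n - k))"
    \<comment> \<open>After the shift, \<open>?f k\<close> and \<open>?g (Suc k)\<close> carry the
      same falling factorials, so Pascal's rule merges them.\<close>
    unfolding sum.atMost_Suc_shift[of _ n]
    by (simp add: sum.distrib algebra_simps)
  finally show ?case .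
qed

text \<open>Multiplying by the next factor \<open>x - \<alpha> - n\<close> acts on coefficients
  exactly as the recurrence does.\<close>

lemma noncentral_stirling_eq_coeff:
  "noncentral_stirling n i \<alpha> = coeff (falling_fact [:- \<alpha>, 1:] n) i"
proof (induction n arbitrary: i)
  case 0
  show ?case by (cases i) simp_all
next
  case (Suc n)
  \<comment> \<open>Covers the boundary cases of the recurrence, where the default value 0 must
    agree with the coefficients above the degree.\<close>
  have zero: "coeff (falling_fact [:- \<alpha>, 1:] n) j = 0" if "n < j" for j
  proof -
    from that have "noncentral_stirling n j \<alpha> = 0"
      by (cases n; cases j) simp_all
    then show ?thesis by (simp add: Suc.IH)
  qed
  have "falling_fact [:- \<alpha>, 1:] (Suc n) =
      pCons 0 (falling_fact [:- \<alpha>, 1:] n) + smult (- \<alpha> - real n) (falling_fact [:- \<alpha>, 1:] n)"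
    by (simp add: falling_fact_Suc of_nat_poly)
  then show ?case
    by (cases i) (auto simp: Suc.IH zero)
qed

lemma falling_fact_const_poly: "falling_fact [:c:] k = [:falling_fact c k:]"
  by (induction k) (simp_all add: falling_fact_Suc of_nat_poly one_pCons mult.commute)

theorem theorem2:
  fixes \<alpha> :: real and n i :: nat
  assumes "\<alpha> \<noteq> 0" and "i \<le> n"
  shows "noncentral_stirling n i \<alpha> =
    (\<Sum>k=0..n-i. real (n choose k) * falling_fact (- \<alpha>) k * signed_stirling (n - k) i)"
proof -
  have "noncentral_stirling n i \<alpha> = coeff (falling_fact ([:- \<alpha>:] + [:0, 1:]) n) i"
    by (simp add: noncentral_stirling_eq_coeff)
  also have "\<dots> = (\<Sum>k\<le>n. real (n choose k) * falling_fact (- \<alpha>) k * signed_stirling (n - k) i)"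
    unfolding falling_fact_add
    by (simp add: coeff_sum falling_fact_const_poly of_nat_poly signed_stirling_def mult_ac)
  also have "\<dots> = (\<Sum>k=0..n-i. real (n choose k) * falling_fact (- \<alpha>) k * signed_stirling (n - k) i)"
    \<comment> \<open>For \<open>n - i < k \<le> n\<close> one has \<open>n - k < i\<close>, so the
      Stirling number is 0.\<close>
    by (rule sum.mono_neutral_right) (use assms(2) in \<open>auto simp: signed_stirling_eq_stirling\<close>)
  finally show ?thesis .
qed

end
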